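(* Let $r_0>0$ and let $f:[r_0,\infty)\to\mathbb{R}$ be a (measurable) function satisfying $\int_{r_0}^{\infty}|f(t)|\,dt<\infty$. Suppose there exists $\psi\in\mathcal{D}(r_0,\infty)$ such that one of the following holds: (i) $\psi(r)^2|f(r)|/\psi'(r)$ is non-decreasing on $(r_1,\infty)$ for some $r_1\ge r_0$; (ii) $|f(r)|/\psi'(r)$ is non-increasing on $(r_1,\infty)$ for some $r_1\ge r_0$. Then $$\lim_{r\to\infty}\frac{\psi(r)}{\psi'(r)}f(r)=0 .$$
   Context: $\mathcal{D}(r_0,\infty)$ denotes the class of positive, unbounded, differentiable and strictly increasing functions on $(r_0,\infty)$. In conditions (i) and (ii) it is understood that the quotients are defined, i.e. $\psi'(r)>0$ for $r\in(r_1,\infty)$. *)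

theory Defs
  imports "HOL-Analysis.Analysis"
begin

definition class_D :: "real \<Rightarrow> (real \<Rightarrow> real) set" where
  "class_D r0 = {\<psi>. (\<forall>r\<in>{r0<..}. \<psi> r > 0) \<and>
     \<not> bounded (\<psi> ` {r0<..}) \<and>
     \<psi> differentiable_on {r0<..} \<and>
     strict_mono_on {r0<..} \<psi>}"

end

theory Submission
  imports Defs
begin

text \<open>
  Write $\psi f/\psi'$ at $r$ as a constant multiple of an integral of the monotone quotient frozen
  at $r$, over a stretch on which $\psi$ doubles. In case (i) one integrates forward, from $r$ to the
  point where $\psi = 2\psi(r)$, against $(-1/\psi)' = \psi'/\psi^2$; in case (ii) backward, from the
  point where $\psi = \psi(r)/2$ to $r$, against $\psi'$. Monotonicity bounds
  $\psi(r)|f(r)|/\psi'(r)$ by twice the integral of $|f|$ over that stretch, and such integrals tend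
  to $0$ because $f$ is absolutely integrable.
\<close>

text \<open>The integrals of |f| from \<open>r0\<close> to b converge as b grows. An integral over
  [a,b] is the difference of two of them, each within e/2 of the limit.\<close>

lemma absolutely_integrable_Cauchy_at_top:
  fixes f :: "real \<Rightarrow> real"
  assumes f: "f absolutely_integrable_on {r0..}" and "e > 0"
  shows "\<exists>A\<ge>r0. \<forall>a b. A \<le> a \<longrightarrow> a \<le> b \<longrightarrow> integral {a..b} (\<lambda>x. \<bar>f x\<bar>) < e"
proof -
  have af: "set_integrable lebesgue {r0..} (\<lambda>x. \<bar>f x\<bar>)"
    using set_integrable_abs[OF f] .
  define I where "I b = integral {r0..b} (\<lambda>x. \<bar>f x\<bar>)" for b
  have sub: "set_integrable lebesgue {a..b} (\<lambda>x. \<bar>f x\<bar>)" if "r0 \<le> a" for a b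
    using that by (intro set_integrable_subset[OF af]) auto
  obtain L where "((\<lambda>b. LINT x:{r0..b}|lebesgue. \<bar>f x\<bar>) \<longlongrightarrow> L) at_top"
    using tendsto_set_lebesgue_integral_at_top[OF _ af] by auto
  \<comment> \<open>The limit is obtained for Lebesgue integrals and moved to gauge integrals, which
    the fundamental theorem of calculus uses below.\<close>
  then have "(I \<longlongrightarrow> L) at_top"
    unfolding I_def by (simp add: set_lebesgue_integral_eq_integral(2)[OF sub])
  then have "\<forall>\<^sub>F b in at_top. dist (I b) L < e / 2"
    using \<open>e > 0\<close> by (intro tendstoD) auto
  then obtain N where N: "\<And>b. b \<ge> N \<Longrightarrow> dist (I b) L < e / 2"
    by (auto simp: eventually_at_top_linorder)
  have "integral {a..b} (\<lambda>x. \<bar>f x\<bar>) < e" if "max N r0 \<le> a" "a \<le> b" for a b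
  proof -
    have "I a + integral {a..b} (\<lambda>x. \<bar>f x\<bar>) = I b"
      unfolding I_def using that set_lebesgue_integral_eq_integral(1)[OF sub[of r0 b]]
      by (intro Henstock_Kurzweil_Integration.integral_combine) auto
    moreover have "\<bar>I a - L\<bar> < e / 2" "\<bar>I b - L\<bar> < e / 2"
      using N[of a] N[of b] that by (auto simp: dist_real_def)
    ultimately show ?thesis
      by linarith
  qed
  then show ?thesis
    by (intro exI[of _ "max N r0"]) auto
qed

lemma derivative_bound_imp_integral_bound:
  fixes F F' g :: "real \<Rightarrow> real"
  assumes "a \<le> b" and g: "g integrable_on {a..b}"
    and F: "\<And>x. x \<in> {a..b} \<Longrightarrow> (F has_real_derivative F' x) (at x)"
    and le: "\<And>x. x \<in> {a..b} \<Longrightarrow> c * F' x \<le> g x"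
  shows "c * (F b - F a) \<le> integral {a..b} g"
proof -
  have "(F' has_integral (F b - F a)) {a..b}"
    using \<open>a \<le> b\<close> F
    by (intro fundamental_theorem_of_calculus)
       (auto simp: has_real_derivative_iff_has_vector_derivative[symmetric]
             intro: has_field_derivative_at_within)
  then have "((\<lambda>x. c * F' x) has_integral (c * (F b - F a))) {a..b}"
    by (rule has_integral_mult_right)
  from has_integral_le[OF this integrable_integral[OF g] le] show ?thesis .
qed

lemma class_D_DERIV:
  assumes "\<psi> \<in> class_D r0" "r0 < x"
  shows "(\<psi> has_real_derivative deriv \<psi> x) (at x)"
proof -
  have "\<psi> differentiable_on {r0<..}"
    using assms by (simp add: class_D_def)
  then have "\<psi> differentiable at x"
    using assms differentiable_on_eq_differentiable_at[of "{r0<..}" \<psi>] by auto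
  then show ?thesis
    by (simp add: DERIV_deriv_iff_real_differentiable)
qed

lemma class_D_pos: "\<psi> \<in> class_D r0 \<Longrightarrow> r0 < x \<Longrightarrow> \<psi> x > 0"
  by (simp add: class_D_def)

lemma class_D_mono: "\<psi> \<in> class_D r0 \<Longrightarrow> r0 < x \<Longrightarrow> x \<le> y \<Longrightarrow> \<psi> x \<le> \<psi> y"
  by (cases "x = y") (auto simp: class_D_def strict_mono_on_def less_imp_le)

text \<open>A bound on \<psi> to the right of a would, by monotonicity, also hold to the left of a.
  With positivity this would make \<psi> bounded on its whole domain.\<close>

lemma class_D_exists_ge:
  assumes D: "\<psi> \<in> class_D r0" and "r0 < a"
  shows "\<exists>b\<ge>a. M \<le> \<psi> b"
proof (rule ccontr)
  assume "\<not> ?thesis"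
  then have less: "\<psi> b < M" if "b \<ge> a" for b
    using that by force
  have "norm (\<psi> x) \<le> M" if "r0 < x" for x
    using class_D_mono[OF D that, of "max x a"] less[of "max x a"] class_D_pos[OF D that] by auto
  then have "bounded (\<psi> ` {r0<..})"
    by (auto simp: bounded_iff)
  with D show False
    by (simp add: class_D_def)
qed

lemma class_D_IVT:
  assumes D: "\<psi> \<in> class_D r0" and "r0 < a" "a \<le> b" "\<psi> a \<le> y" "y \<le> \<psi> b"
  obtains s where "a \<le> s" "s \<le> b" "\<psi> s = y"
proof -
  have "isCont \<psi> x" if "a \<le> x \<and> x \<le> b" for x
    using class_D_DERIV[OF D, of x] that assms by (intro DERIV_isCont) auto
  then show ?thesis
    using IVT[of \<psi> a y b] assms that by blast
qed

theorem theorem5p3: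
  fixes r0 :: real and f \<psi> :: "real \<Rightarrow> real"
  assumes "r0 > 0"
    and "f absolutely_integrable_on {r0..}"
    and "\<psi> \<in> class_D r0"
    and "(\<exists>r1\<ge>r0. (\<forall>r\<in>{r1<..}. deriv \<psi> r > 0) \<and>
             mono_on {r1<..} (\<lambda>r. (\<psi> r)\<^sup>2 * \<bar>f r\<bar> / deriv \<psi> r)) \<or>
         (\<exists>r1\<ge>r0. (\<forall>r\<in>{r1<..}. deriv \<psi> r > 0) \<and>
             antimono_on {r1<..} (\<lambda>r. \<bar>f r\<bar> / deriv \<psi> r))"
  shows "((\<lambda>r. \<psi> r / deriv \<psi> r * f r) \<longlongrightarrow> 0) at_top"
proof -
  note D = assms(3)
  note pos = class_D_pos[OF D] and DERIV = class_D_DERIV[OF D]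
  have int: "(\<lambda>x. \<bar>f x\<bar>) integrable_on {a..b}" if "r0 < a" for a b
    using that
    by (intro set_lebesgue_integral_eq_integral(1)
              set_integrable_subset[OF set_integrable_abs[OF assms(2)]]) auto
  \<comment> \<open>Both cases yield this one bound. The threshold N may exceed A because in case
    (ii) the stretch ends at r and must still start beyond A.\<close>
  have ex: "\<exists>N\<ge>A. \<forall>r\<ge>N. \<exists>a b. A \<le> a \<and> a \<le> b \<and>
      \<psi> r / deriv \<psi> r * \<bar>f r\<bar> \<le> 2 * integral {a..b} (\<lambda>x. \<bar>f x\<bar>) \<and> deriv \<psi> r > 0"
      (is "\<exists>N\<ge>A. \<forall>r\<ge>N. ?P A r")
    if *: "A > r1" "r1 \<ge> r0" "\<forall>r\<in>{r1<..}. deriv \<psi> r > 0"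
     "mono_on {r1<..} (\<lambda>r. (\<psi> r)\<^sup>2 * \<bar>f r\<bar> / deriv \<psi> r) \<or>
      antimono_on {r1<..} (\<lambda>r. \<bar>f r\<bar> / deriv \<psi> r)" for A r1
    using *(4)
  proof
    assume mono: "mono_on {r1<..} (\<lambda>r. (\<psi> r)\<^sup>2 * \<bar>f r\<bar> / deriv \<psi> r)"
    have "?P A r" if "r \<ge> A" for r
    proof -
      have r: "r1 < r" "r0 < r" using that *(1-3) by auto
      obtain b where "r \<le> b" "2 * \<psi> r \<le> \<psi> b"
        using class_D_exists_ge[OF D r(2)] by blast
      then obtain s where s: "r \<le> s" "\<psi> s = 2 * \<psi> r"
        using class_D_IVT[OF D r(2), of b "2 * \<psi> r"] pos[OF r(2)] by auto
      define c where "c = (\<psi> r)\<^sup>2 * \<bar>f r\<bar> / deriv \<psi> r"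
      have "c * (- inverse (\<psi> s) - - inverse (\<psi> r)) \<le> integral {r..s} (\<lambda>x. \<bar>f x\<bar>)"
      proof (rule derivative_bound_imp_integral_bound[OF s(1) int[OF r(2)]])
        fix x assume x: "x \<in> {r..s}"
        then have p: "\<psi> x > 0" "deriv \<psi> x > 0" using r pos *(1-3) by auto
        show "((\<lambda>x. - inverse (\<psi> x)) has_real_derivative deriv \<psi> x / (\<psi> x)\<^sup>2) (at x)"
          using DERIV_minus[OF DERIV_inverse_fun[OF DERIV[of x]]] p x r
          by (simp add: power2_eq_square field_simps)
        \<comment> \<open>The stretch lies to the right of r, so a non-decreasing quotient is
          smallest at r.\<close>
        have "c \<le> (\<psi> x)\<^sup>2 * \<bar>f x\<bar> / deriv \<psi> x"
          unfolding c_def using x r by (intro mono_onD[OF mono]) auto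
        then show "c * (deriv \<psi> x / (\<psi> x)\<^sup>2) \<le> \<bar>f x\<bar>"
          using p by (simp add: field_simps)
      qed
      \<comment> \<open>Since \<psi>(s) = 2\<psi>(r), the increment of -1/\<psi> is 1/(2\<psi>(r)),
        which cancels one factor \<psi>(r) of c and leaves the 1/2.\<close>
      moreover have "c * (- inverse (\<psi> s) - - inverse (\<psi> r)) = \<psi> r / deriv \<psi> r * \<bar>f r\<bar> / 2"
        using pos[OF r(2)] *(3) r by (simp add: s c_def field_simps power2_eq_square)
      ultimately show ?thesis
        using s(1) that r *(1-3) by (intro exI[of _ r] exI[of _ s]) auto
    qed
    then show ?thesis by blast
  next
    assume anti: "antimono_on {r1<..} (\<lambda>r. \<bar>f r\<bar> / deriv \<psi> r)"
    have A: "r0 < A" using *(1-3) by auto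
    \<comment> \<open>For r beyond this N, \<psi>(A) is at most \<psi>(r)/2, so the point where
      \<psi> equals \<psi>(r)/2 lies in [A,r].\<close>
    obtain N where N: "A \<le> N" "2 * \<psi> A \<le> \<psi> N"
      using class_D_exists_ge[OF D A] by blast
    have "?P A r" if "r \<ge> N" for r
    proof -
      have r: "r1 < r" "r0 < r" "A \<le> r" using that N *(1-3) by auto
      have "2 * \<psi> A \<le> \<psi> r"
        using class_D_mono[OF D _ that] N A by auto
      then obtain s where s: "A \<le> s" "s \<le> r" "\<psi> s = \<psi> r / 2"
        using class_D_IVT[OF D A r(3), of "\<psi> r / 2"] pos[OF r(2)] by auto
      define c where "c = \<bar>f r\<bar> / deriv \<psi> r"
      have "c * (\<psi> r - \<psi> s) \<le> integral {s..r} (\<lambda>x. \<bar>f x\<bar>)"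
      proof (rule derivative_bound_imp_integral_bound[OF s(2) int])
        show "r0 < s" using s A by auto
        fix x assume x: "x \<in> {s..r}"
        then have x1: "r1 < x" using s *(1-3) by auto
        then show "(\<psi> has_real_derivative deriv \<psi> x) (at x)"
          using *(1-3) by (intro DERIV) auto
        \<comment> \<open>Now the stretch lies to the left of r, where a non-increasing quotient is
          at least its value at r.\<close>
        have "c \<le> \<bar>f x\<bar> / deriv \<psi> x"
          unfolding c_def using x r x1 by (intro monotone_onD[OF anti, simplified]) auto
        then show "c * deriv \<psi> x \<le> \<bar>f x\<bar>"
          using x1 *(3) by (simp add: field_simps)
      qed
      moreover have "c * (\<psi> r - \<psi> s) = \<psi> r / deriv \<psi> r * \<bar>f r\<bar> / 2"
        by (simp add: s c_def)
      ultimately show ?thesis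
        using s r *(1-3) by (intro exI[of _ s] exI[of _ r]) auto
    qed
    with N(1) show ?thesis by blast
  qed
  obtain r1 where r1: "r1 \<ge> r0" "\<forall>r\<in>{r1<..}. deriv \<psi> r > 0"
     "mono_on {r1<..} (\<lambda>r. (\<psi> r)\<^sup>2 * \<bar>f r\<bar> / deriv \<psi> r) \<or>
      antimono_on {r1<..} (\<lambda>r. \<bar>f r\<bar> / deriv \<psi> r)"
    using assms(4) by blast
  show ?thesis
  proof (rule tendstoI)
    fix e :: real assume "e > 0"
    \<comment> \<open>The e/2 absorbs the factor 2 in front of the integral in
      \<open>ex\<close>.\<close>
    then obtain A0 where A0: "\<And>a b. A0 \<le> a \<Longrightarrow> a \<le> b \<Longrightarrow> integral {a..b} (\<lambda>x. \<bar>f x\<bar>) < e / 2"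
      using absolutely_integrable_Cauchy_at_top[OF assms(2), of "e / 2"] by auto
    \<comment> \<open>Adding 1 puts A strictly inside the open ray on which the quotient is
      monotone.\<close>
    define A where "A = max A0 (r1 + 1)"
    have A: "A \<ge> A0" "A > r1" by (auto simp: A_def)
    from ex[OF A(2) r1] obtain N where N: "N \<ge> A" and
      bound: "\<And>r. r \<ge> N \<Longrightarrow> \<exists>a b. A \<le> a \<and> a \<le> b \<and>
      \<psi> r / deriv \<psi> r * \<bar>f r\<bar> \<le> 2 * integral {a..b} (\<lambda>x. \<bar>f x\<bar>) \<and> deriv \<psi> r > 0"
      by blast
    have "dist (\<psi> r / deriv \<psi> r * f r) 0 < e" if "r \<ge> N" for r
    proof -
      obtain a b where ab: "A \<le> a" "a \<le> b" "deriv \<psi> r > 0"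
        "\<psi> r / deriv \<psi> r * \<bar>f r\<bar> \<le> 2 * integral {a..b} (\<lambda>x. \<bar>f x\<bar>)"
        using bound[OF \<open>r \<ge> N\<close>] by blast
      have "\<psi> r > 0"
        using that N A r1 by (intro pos) auto
      then have "dist (\<psi> r / deriv \<psi> r * f r) 0 = \<psi> r / deriv \<psi> r * \<bar>f r\<bar>"
        using ab(3) by (simp add: abs_mult)
      with ab A0[of a b] A show ?thesis by linarith
    qed
    then show "\<forall>\<^sub>F r in at_top. dist (\<psi> r / deriv \<psi> r * f r) 0 < e"
      by (auto simp: eventually_at_top_linorder)
  qed
qed

end
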